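(* Let $n\ge 2$. The graph $\Gamma(\mathbb{Z}_n)$ is chordal if and only if $n=p^x$, $n=2p$, or $n=2p^2$ for some prime $p$ and positive integer $x$.
   Context: For a commutative ring $R$ with identity, the zero-divisor graph $\Gamma(R)$ is the simple undirected graph whose vertices are the nonzero zero-divisors of $R$, two distinct vertices $u,v$ being adjacent iff $uv=0$. A graph is chordal if every cycle of length greater than $3$ has a chord (an edge joining two non-consecutive vertices of the cycle). *)

theory Defs
  imports "HOL-Number_Theory.Residues" "Graph_Theory.Graph_Theory"
begin

text \<open>As in the graph library, an undirected graph is a symmetric digraph. The ring is meant to
  be commutative, so no distinction is made between left and right zero-divisors.\<close>

definition zero_divisors :: "('a, 'm) ring_scheme \<Rightarrow> 'a set" where
  "zero_divisors R = {x \<in> carrier R. \<exists>y \<in> carrier R. y \<noteq> \<zero>\<^bsub>R\<^esub> \<and> x \<otimes>\<^bsub>R\<^esub> y = \<zero>\<^bsub>R\<^esub>}"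

definition zero_divisor_graph :: "('a, 'm) ring_scheme \<Rightarrow> 'a pair_pre_digraph" where
  "zero_divisor_graph R = \<lparr>
     pverts = zero_divisors R - {\<zero>\<^bsub>R\<^esub>},
     parcs = {(u, v). u \<in> zero_divisors R - {\<zero>\<^bsub>R\<^esub>} \<and> v \<in> zero_divisors R - {\<zero>\<^bsub>R\<^esub>} \<and>
                      u \<noteq> v \<and> u \<otimes>\<^bsub>R\<^esub> v = \<zero>\<^bsub>R\<^esub>}\<rparr>"

lemma (in cring) pair_bidirected_digraph_zero_divisor_graph:
  "pair_bidirected_digraph (zero_divisor_graph R)"
proof unfold_locales
  show "symmetric (with_proj (zero_divisor_graph R))"
    unfolding symmetric_def
  proof (rule symI)
    fix u v
    assume "u \<rightarrow>\<^bsub>with_proj (zero_divisor_graph R)\<^esub> v"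
    moreover from this have "v \<otimes> u = u \<otimes> v"
      by (intro m_comm) (auto simp: zero_divisor_graph_def zero_divisors_def)
    ultimately show "v \<rightarrow>\<^bsub>with_proj (zero_divisor_graph R)\<^esub> u"
      by (auto simp: zero_divisor_graph_def)
  qed
qed (auto simp: zero_divisor_graph_def)

text \<open>The vertices of a cycle \<open>p\<close>, in cyclic order, are the tails of its arcs. The positions
  \<open>i < j\<close> are non-consecutive on the cycle if \<open>j \<noteq> i + 1\<close> and they are not the first and the last
  position.\<close>

definition has_chord :: "('a, 'b) pre_digraph \<Rightarrow> 'b awalk \<Rightarrow> bool" where
  "has_chord G p \<longleftrightarrow>
     (\<exists>i j. i < j \<and> j < length p \<and> j \<noteq> i + 1 \<and> \<not> (i = 0 \<and> j = length p - 1) \<and>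
        tail G (p ! i) \<rightarrow>\<^bsub>G\<^esub> tail G (p ! j))"

text \<open>The directed cycles of the library include closed walks of length 2 (and loops), but for
  length greater than 3 they are exactly the cycles of the underlying undirected graph.\<close>

definition chordal :: "('a, 'b) pre_digraph \<Rightarrow> bool" where
  "chordal G \<longleftrightarrow> (\<forall>p. pre_digraph.cycle G p \<and> length p > 3 \<longrightarrow> has_chord G p)"

end

theory Submission
  imports Defs
begin

text \<open>For \<open>n = p\<^sup>x\<close>, \<open>n = 2p\<close> and \<open>n = 2p\<^sup>2\<close> with \<open>p\<close> odd, the graph is a split graph, hence
  chordal: the clique consists of the elements of square zero, of \<open>p\<close> alone, and of the elements
  of square zero together with \<open>p\<^sup>2\<close>, respectively. For the converse, if \<open>n = ab\<close> with
  \<open>a, b \<ge> 3\<close> coprime, then \<open>a, b, 2a, 2b\<close> is a chordless 4-cycle, and if \<open>n = 2p\<^sup>k\<close> with \<open>p\<close> odd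
  and \<open>k \<ge> 3\<close>, then so is \<open>2p, p\<^bsup>k-1\<^esup>, 4p, p\<^sup>k\<close>.\<close>

section \<open>Edges of the graph of the integers modulo \<open>m\<close>\<close>

text \<open>\<open>u\<close> and \<open>v\<close> witness each other to be zero-divisors, so the
  divisibility already makes both of them vertices.\<close>

lemma arc_zero_divisor_graph_residue_ring:
  "u \<rightarrow>\<^bsub>with_proj (zero_divisor_graph (residue_ring m))\<^esub> v \<longleftrightarrow>
    0 < u \<and> u < m \<and> 0 < v \<and> v < m \<and> u \<noteq> v \<and> m dvd u * v"
  (is "?L \<longleftrightarrow> ?R")
proof
  assume ?L
  then show ?R
    by (auto simp: zero_divisor_graph_def zero_divisors_def residue_ring_def)
next
  assume ?R
  then have "(u * v) mod m = 0" "(v * u) mod m = 0"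
    by (auto simp: mult.commute)
  with \<open>?R\<close> have "u \<in> zero_divisors (residue_ring m)" "v \<in> zero_divisors (residue_ring m)"
    unfolding zero_divisors_def by (auto simp: residue_ring_def intro: bexI[of _ v] bexI[of _ u])
  with \<open>?R\<close> show ?L
    by (auto simp: zero_divisor_graph_def residue_ring_def)
qed

section \<open>Criteria for chordal and non-chordal graphs\<close>

text \<open>On a chordless cycle of length at least 4, any two vertices of \<open>K\<close> are
  consecutive, so there are at most two of them. Then some two consecutive vertices lie outside
  \<open>K\<close>, although every edge meets \<open>K\<close>.\<close>

lemma chordal_if_split:
  assumes clique: "\<And>u v. u \<in> K \<Longrightarrow> v \<in> K \<Longrightarrow> u \<in> verts G \<Longrightarrow> v \<in> verts G \<Longrightarrow> u \<noteq> v \<Longrightarrow> u \<rightarrow>\<^bsub>G\<^esub> v"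
    and indep: "\<And>u v. u \<rightarrow>\<^bsub>G\<^esub> v \<Longrightarrow> u \<in> K \<or> v \<in> K"
    and wf: "wf_digraph G"
  shows "chordal G"
  unfolding chordal_def
proof (intro allI impI, elim conjE)
  interpret wf_digraph G by (rule wf)
  fix p assume "cycle p" and len: "length p > 3"
  then obtain u where walk: "awalk u p u" and dist: "distinct (tl (awalk_verts u p))"
    by (auto simp: cycle_def)
  have cas: "cas u p u" and arcs: "set p \<subseteq> arcs G"
    using walk by (auto simp: awalk_def)
  define w where "w i = tail G (p ! i)" for i
  have ends: "tail G (hd p) = u" "head G (last p) = u"
    using cas len awlast_if_cas[OF cas] by (auto simp: cas_simp awalk_verts_conv split: if_splits)
  \<comment> \<open>Both sides list the vertices of the closed walk, by tails and by heads.
    Comparing entries \<open>Suc i\<close> shows that arc \<open>i\<close> ends where arc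
    \<open>Suc i\<close> starts.\<close>
  have verts: "map (tail G) p @ [u] = u # map (head G) p"
    using awalk_verts_conv[of u p] awalk_verts_conv'[OF cas] ends len by (auto split: if_splits)
  have step: "w i \<rightarrow>\<^bsub>G\<^esub> w (Suc i)" if "Suc i < length p" for i
  proof -
    have "head G (p ! i) = w (Suc i)"
      using arg_cong[OF verts, of "\<lambda>xs. xs ! Suc i"] that by (simp add: w_def nth_append)
    then show ?thesis
      using arcs that by (auto simp: w_def arc_to_ends_def intro!: dominatesI[where a = "p ! i"])
  qed
  have last: "w (length p - 1) \<rightarrow>\<^bsub>G\<^esub> w 0"
    using arcs len ends last_in_set[of p] hd_conv_nth[of p] last_conv_nth[of p]
    by (intro dominatesI[where a = "last p"]) (auto simp: w_def arc_to_ends_def simp flip: length_greater_0_conv)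
  \<comment> \<open>\<open>cycle\<close> makes the vertex list without its first entry distinct;
    that list is a rotation of the list of tails.\<close>
  have inj: "w i \<noteq> w j" if "i < j" "j < length p" for i j
  proof -
    have "awalk_verts u p = map (tail G) p @ [u]"
      using awalk_verts_conv[of u p] ends len by auto
    with dist ends have "distinct (map (tail G) p)"
      by (cases p) auto
    then show ?thesis
      using that by (auto simp: w_def distinct_conv_nth)
  qed
  have vert: "w i \<in> verts G" if "i < length p" for i
    unfolding w_def using that arcs nth_mem tail_in_verts by blast
  have chord: "has_chord G p"
    if "i < j" "j < length p" "j \<noteq> i + 1" "i \<noteq> 0 \<or> j \<noteq> length p - 1" "w i \<in> K" "w j \<in> K" for i j
    using that clique[of "w i" "w j"] inj[of i j] vert[of i] vert[of j]
    unfolding has_chord_def w_def[symmetric] by auto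
  show "has_chord G p"
  proof (rule ccontr)
    assume "\<not> has_chord G p"
    with chord have no: "\<not> (w i \<in> K \<and> w j \<in> K)"
      if "i < j" "j < length p" "j \<noteq> i + 1" "i \<noteq> 0 \<or> j \<noteq> length p - 1" for i j
      using that by blast
    \<comment> \<open>For length 4 the closing edge from position 3 to 0 completes the
      contradiction. In a longer cycle 0 and 3 are not consecutive, and the edge from 3 to 4 is used
      instead.\<close>
    have s: "w 0 \<in> K \<or> w 1 \<in> K" "w 1 \<in> K \<or> w 2 \<in> K" "w 2 \<in> K \<or> w 3 \<in> K"
      using step[of 0] step[of 1] step[of 2] indep len by (auto simp: numeral_eq_Suc)
    have n: "\<not> (w 0 \<in> K \<and> w 2 \<in> K)" "\<not> (w 1 \<in> K \<and> w 3 \<in> K)"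
      using no[of 0 2] no[of 1 3] len by auto
    show False
    proof (cases "length p = 4")
      case True
      then have "w 3 \<in> K \<or> w 0 \<in> K" using last indep[of "w 3" "w 0"] by simp
      then show False using s n by blast
    next
      case False
      then have "w 3 \<in> K \<or> w 4 \<in> K" "\<not> (w 1 \<in> K \<and> w 4 \<in> K)" "\<not> (w 2 \<in> K \<and> w 4 \<in> K)"
          "\<not> (w 0 \<in> K \<and> w 3 \<in> K)"
        using step[of 3] indep[of "w 3" "w 4"] no[of 1 4] no[of 2 4] no[of 0 3] len by auto
      then show False using s n by blast
    qed
  qed
qed

text \<open>The two diagonals are the only candidates for a chord, and \<open>has_chord\<close>
  tests each only from the earlier position to the later.\<close>

lemma not_chordal_if_4_cycle:
  assumes "a \<rightarrow>\<^bsub>with_proj G\<^esub> b" "b \<rightarrow>\<^bsub>with_proj G\<^esub> c" "c \<rightarrow>\<^bsub>with_proj G\<^esub> d" "d \<rightarrow>\<^bsub>with_proj G\<^esub> a"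
    and "a \<in> pverts G" "distinct [a, b, c, d]"
    and "\<not> a \<rightarrow>\<^bsub>with_proj G\<^esub> c" "\<not> b \<rightarrow>\<^bsub>with_proj G\<^esub> d"
  shows "\<not> chordal (with_proj G)"
proof -
  let ?p = "[(a, b), (b, c), (c, d), (d, a)]"
  have "pre_digraph.cycle (with_proj G) ?p"
    unfolding pre_digraph.cycle_def pre_digraph.awalk_def
    using assms by (auto intro!: exI[of _ a] simp: pre_digraph.cas.simps pre_digraph.awalk_verts.simps)
  moreover have "\<not> has_chord (with_proj G) ?p"
  proof
    assume "has_chord (with_proj G) ?p"
    then obtain i j where ij: "i < j" "j < 4" "j \<noteq> i + 1" "\<not> (i = 0 \<and> j = 3)"
      and arc: "fst (?p ! i) \<rightarrow>\<^bsub>with_proj G\<^esub> fst (?p ! j)"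
      by (auto simp: has_chord_def)
    from ij have "i = 0 \<and> j = 2 \<or> i = 1 \<and> j = 3" by presburger
    with arc assms show False by auto
  qed
  ultimately show ?thesis by (auto simp: chordal_def)
qed

section \<open>Chordal moduli\<close>

text \<open>\<open>K\<close> is a set of arbitrary integers, so that it can be given by a
  divisibility condition; only its members among the vertices form the clique.\<close>

lemma chordal_zero_divisor_graph_if_split:
  fixes m :: int
  assumes "\<And>u v. u \<in> K \<Longrightarrow> v \<in> K \<Longrightarrow> u \<noteq> v \<Longrightarrow> m dvd u * v"
    and "\<And>u v. 0 < u \<Longrightarrow> u < m \<Longrightarrow> 0 < v \<Longrightarrow> v < m \<Longrightarrow> m dvd u * v \<Longrightarrow> u \<in> K \<or> v \<in> K"
  shows "chordal (with_proj (zero_divisor_graph (residue_ring m)))"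
proof (rule chordal_if_split[where K = K])
  let ?G = "with_proj (zero_divisor_graph (residue_ring m))"
  show "wf_digraph ?G"
    by unfold_locales (auto simp: zero_divisor_graph_def)
  show "u \<in> K \<or> v \<in> K" if "u \<rightarrow>\<^bsub>?G\<^esub> v" for u v
    using that assms(2) unfolding arc_zero_divisor_graph_residue_ring by blast
  show "u \<rightarrow>\<^bsub>?G\<^esub> v" if "u \<in> K" "v \<in> K" "u \<in> verts ?G" "v \<in> verts ?G" "u \<noteq> v" for u v
    unfolding arc_zero_divisor_graph_residue_ring using that assms(1)
    by (auto simp: zero_divisor_graph_def zero_divisors_def residue_ring_def)
qed

text \<open>If \<open>p ^ x\<close> divides \<open>u * v\<close>, the exponents of \<open>p\<close>
  in \<open>u\<close> and \<open>v\<close> add up to at least \<open>x\<close>, so one of them is at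
  least half of \<open>x\<close>.\<close>

lemma chordal_prime_power:
  fixes p :: int
  assumes "prime p"
  shows "chordal (with_proj (zero_divisor_graph (residue_ring (p ^ x))))"
proof (rule chordal_zero_divisor_graph_if_split[where K = "{u. p ^ x dvd u ^ 2}"])
  fix u v :: int
  assume "u \<in> {u. p ^ x dvd u ^ 2}" "v \<in> {u. p ^ x dvd u ^ 2}"
  then have "p ^ x * p ^ x dvd u ^ 2 * v ^ 2"
    by (auto intro: mult_dvd_mono)
  then have "(p ^ x) ^ 2 dvd (u * v) ^ 2"
    by (simp add: power2_eq_square mult_ac)
  then show "p ^ x dvd u * v"
    by simp
next
  fix u v :: int
  assume "0 < u" "0 < v" and dvd: "p ^ x dvd u * v"
  \<comment> \<open>Distributing \<open>p ^ x\<close> over the two factors gives powers of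
    \<open>p\<close> up to sign; \<open>normalize\<close> removes the sign.\<close>
  obtain a b where ab: "p ^ x = a * b" "a dvd u" "b dvd v"
    using dvd by (rule dvd_productE)
  obtain i where i: "normalize a = p ^ i"
    using divides_primepow[OF assms, of a x] ab(1) by auto
  obtain j where j: "normalize b = p ^ j"
    using divides_primepow[OF assms, of b x] ab(1) by auto
  have "p ^ x = normalize (p ^ x)"
    using prime_ge_0_int[OF assms] by simp
  also have "\<dots> = p ^ (i + j)"
    by (simp only: ab(1) normalize_mult i j power_add)
  finally have "x = i + j"
    using assms power_inject_exp prime_gt_1_int by blast
  moreover have "p ^ i dvd u" "p ^ j dvd v"
    using ab i j by (metis normalize_dvd_iff)+
  ultimately have ij: "p ^ i dvd u" "p ^ j dvd v" "x = i + j"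
    by auto
  have "p ^ x dvd w ^ 2" if "x \<le> 2 * k" "p ^ k dvd w" for k w
    using that by (metis dvd_trans le_imp_power_dvd mult.commute power_mult dvd_power_same)
  moreover have "x \<le> 2 * i \<or> x \<le> 2 * j"
    using ij by linarith
  ultimately show "u \<in> {u. p ^ x dvd u ^ 2} \<or> v \<in> {u. p ^ x dvd u ^ 2}"
    using ij by blast
qed

text \<open>It singles out \<open>p\<close> as the only multiple of \<open>p\<close> among the
  vertices modulo \<open>2 * p\<close>, and likewise \<open>p ^ 2\<close> modulo
  \<open>2 * p ^ 2\<close>.\<close>

lemma eq_if_dvd_less_double:
  fixes a b :: int
  assumes "a dvd b" "0 < b" "b < 2 * a"
  shows "b = a"
proof -
  from assms obtain k where k: "b = a * k" by blast
  have "a > 0" using assms by linarith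
  with k assms have "0 < k" "k < 2"
    by (auto simp: zero_less_mult_iff mult.commute)
  with k show ?thesis by simp
qed

lemma chordal_double_prime:
  fixes p :: int
  assumes "prime p"
  shows "chordal (with_proj (zero_divisor_graph (residue_ring (2 * p))))"
proof (rule chordal_zero_divisor_graph_if_split[where K = "{p}"])
  fix u v :: int
  assume uv: "0 < u" "u < 2 * p" "0 < v" "v < 2 * p" "2 * p dvd u * v"
  then have "p dvd u \<or> p dvd v"
    using assms by (metis dvd_mult_right prime_dvd_mult_iff)
  with uv eq_if_dvd_less_double show "u \<in> {p} \<or> v \<in> {p}"
    by blast
qed auto

lemma chordal_double_prime_square:
  fixes p :: int
  assumes "prime p" "odd p"
  shows "chordal (with_proj (zero_divisor_graph (residue_ring (2 * p ^ 2))))"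
proof (rule chordal_zero_divisor_graph_if_split[where K = "insert (p ^ 2) {u. 2 * p dvd u}"])
  fix u v :: int
  \<comment> \<open>All members of \<open>K\<close> are multiples of \<open>p\<close>, and of two
    distinct ones at least one is not \<open>p ^ 2\<close>, hence a multiple of
    \<open>2 * p\<close>.\<close>
  have "2 * p ^ 2 dvd u * v" if "2 * p dvd u" "p dvd v" for u v
    using mult_dvd_mono[OF that] by (simp add: power2_eq_square mult_ac)
  moreover assume "u \<in> insert (p ^ 2) {u. 2 * p dvd u}" "v \<in> insert (p ^ 2) {u. 2 * p dvd u}" "u \<noteq> v"
  ultimately show "2 * p ^ 2 dvd u * v"
    by (auto simp: mult.commute intro: dvd_mult_left dvd_mult_right)
next
  \<comment> \<open>One factor is even, by symmetry \<open>u\<close>. If \<open>p\<close> does not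
    divide it, the whole of \<open>p ^ 2\<close> falls to \<open>v\<close>.\<close>
  have *: "u = p ^ 2 \<or> v = p ^ 2 \<or> 2 * p dvd u"
    if "0 < u" "u < 2 * p ^ 2" "0 < v" "v < 2 * p ^ 2" "2 * p ^ 2 dvd u * v" "even u" for u v
  proof (cases "p dvd u")
    case True
    then show ?thesis
      using that assms by (auto intro!: divides_mult)
  next
    case False
    then have "coprime (p ^ 2) u"
      using assms by (simp add: prime_imp_coprime)
    moreover have "p ^ 2 dvd u * v"
      using that by (metis dvd_mult_right)
    ultimately have "p ^ 2 dvd v"
      by (simp add: coprime_dvd_mult_right_iff)
    then show ?thesis
      using eq_if_dvd_less_double that by blast
  qed
  fix u v :: int
  assume uv: "0 < u" "u < 2 * p ^ 2" "0 < v" "v < 2 * p ^ 2" "2 * p ^ 2 dvd u * v"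
  then have "even u \<or> even v"
    by (metis dvd_mult_left even_mult_iff)
  then show "u \<in> insert (p ^ 2) {u. 2 * p dvd u} \<or> v \<in> insert (p ^ 2) {u. 2 * p dvd u}"
    using *[of u v] *[of v u] uv by (auto simp: mult.commute)
qed

section \<open>Moduli with a chordless 4-cycle\<close>

text \<open>Doubling \<open>x\<close> keeps its neighbours \<open>y\<close> and \<open>z\<close>,
  which yields the cycle \<open>x, y, 2 * x, z\<close>.\<close>

lemma not_chordal_zero_divisor_graph:
  fixes m x y z :: int
  assumes "0 < x" "2 * x < m" "0 < y" "y < m" "0 < z" "z < m" "y \<noteq> z"
    and "m dvd x * y" "m dvd x * z" "\<not> m dvd 2 * x ^ 2" "\<not> m dvd y * z"
  shows "\<not> chordal (with_proj (zero_divisor_graph (residue_ring m)))"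
proof (rule not_chordal_if_4_cycle[where a = x and b = y and c = "2 * x" and d = z])
  \<comment> \<open>Any of these equalities would make \<open>m\<close> divide
    \<open>2 * x ^ 2\<close>.\<close>
  have [simp]: "x \<noteq> y" "x \<noteq> z" "y \<noteq> 2 * x" "z \<noteq> 2 * x"
    using assms by (auto simp: power2_eq_square mult_ac)
  then show "distinct [x, y, 2 * x, z]"
    using assms by auto
  let ?G = "with_proj (zero_divisor_graph (residue_ring m))"
  show arc: "x \<rightarrow>\<^bsub>?G\<^esub> y"
    unfolding arc_zero_divisor_graph_residue_ring using assms by auto
  show "y \<rightarrow>\<^bsub>?G\<^esub> (2 * x)" "(2 * x) \<rightarrow>\<^bsub>?G\<^esub> z" "z \<rightarrow>\<^bsub>?G\<^esub> x"
    "\<not> x \<rightarrow>\<^bsub>?G\<^esub> (2 * x)" "\<not> y \<rightarrow>\<^bsub>?G\<^esub> z"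
    unfolding arc_zero_divisor_graph_residue_ring
    using assms dvd_mult[of m "x * y" 2] dvd_mult[of m "x * z" 2]
    by (auto simp: power2_eq_square mult_ac)
  show "x \<in> pverts (zero_divisor_graph (residue_ring m))"
    using arc by (auto simp: zero_divisor_graph_def)
qed

lemma not_chordal_coprime:
  fixes a b :: int
  assumes "coprime a b" "a \<ge> 3" "b \<ge> 3"
  shows "\<not> chordal (with_proj (zero_divisor_graph (residue_ring (a * b))))"
proof -
  \<comment> \<open>Stated for fresh \<open>a\<close> and \<open>b\<close> because it excludes both
    diagonals, the second one with the roles exchanged.\<close>
  have *: "\<not> a * b dvd 2 * a ^ 2" if "coprime a b" "a \<ge> 3" "b \<ge> 3" for a b :: int
  proof
    assume "a * b dvd 2 * a ^ 2"
    then have "b dvd 2 * a"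
      using that by (simp add: power2_eq_square mult.left_commute[of 2])
    then have "b dvd 2"
      using that by (simp add: coprime_dvd_mult_left_iff coprime_commute)
    then show False
      using that zdvd_imp_le by fastforce
  qed
  show ?thesis
  proof (rule not_chordal_zero_divisor_graph[of a _ b "2 * b"])
    show "\<not> a * b dvd 2 * a ^ 2" "\<not> a * b dvd b * (2 * b)"
      using *[of a b] *[of b a] assms by (auto simp: power2_eq_square mult_ac coprime_commute)
    show "2 * a < a * b" "b < a * b" "2 * b < a * b"
      using assms by (auto simp: mult.commute)
  qed (use assms in auto)
qed

lemma not_chordal_double_prime_power:
  fixes p :: int
  assumes "prime p" "odd p" "k \<ge> 3"
  shows "\<not> chordal (with_proj (zero_divisor_graph (residue_ring (2 * p ^ k))))"
proof -
  obtain j where k: "k = Suc (Suc (Suc j))"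
    using that[of "k - 3"] assms(3) by simp
  have p: "p \<ge> 3"
    using assms prime_ge_2_int[of p] by (cases "p = 2") auto
  show ?thesis
  proof (rule not_chordal_zero_divisor_graph[of "2 * p" _ "p ^ Suc (Suc j)" "p ^ k"])
    show "\<not> 2 * p ^ k dvd 2 * (2 * p) ^ 2"
    \<comment> \<open>Cancelling \<open>2 * p ^ 2\<close> leaves \<open>p ^ (k - 2)\<close> dividing
      4, with positive exponent and odd \<open>p\<close>.\<close>
    proof
      assume "2 * p ^ k dvd 2 * (2 * p) ^ 2"
      moreover have "2 * p ^ k = 2 * p ^ 2 * (p * p ^ j)" "2 * (2 * p) ^ 2 = 2 * p ^ 2 * 2 ^ 2"
        by (simp_all add: k power2_eq_square)
      ultimately have "2 * p ^ 2 * (p * p ^ j) dvd 2 * p ^ 2 * 2 ^ 2"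
        by simp
      then have "p * p ^ j dvd 2 ^ 2"
        using p by (subst (asm) dvd_mult_cancel_left) auto
      then have "p dvd 2 ^ 2"
        by (rule dvd_mult_left)
      then have "p dvd 2"
        using assms prime_dvd_power by blast
      then show False
        using p zdvd_imp_le by fastforce
    qed
    \<comment> \<open>The right side is odd.\<close>
    show "\<not> 2 * p ^ k dvd p ^ Suc (Suc j) * p ^ k"
      using assms by (metis dvd_mult_left even_mult_iff even_power)
    show "2 * (2 * p) < 2 * p ^ k"
    proof -
      have "2 * p < p ^ 2"
        using p by (simp add: power2_eq_square)
      also have "\<dots> \<le> p ^ k"
        using p assms(3) by (intro power_increasing) auto
      finally show ?thesis by simp
    qed
    have "p ^ Suc (Suc j) \<le> p ^ k"
      using p by (intro power_increasing) (auto simp: k)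
    then show "p ^ Suc (Suc j) < 2 * p ^ k"
      using p zero_less_power[of p k] by linarith
  qed (use p in \<open>auto simp: k\<close>)
qed

section \<open>Classification of the chordal moduli\<close>

text \<open>Of two coprime factors of \<open>n\<close> with product \<open>n\<close>, one is at most
  2. This is applied to the full power of a prime in \<open>n\<close> and its cofactor.\<close>

lemma chordal_cases:
  fixes n :: nat
  assumes "n \<ge> 2" "chordal (with_proj (zero_divisor_graph (residue_ring (int n))))"
  shows "\<exists>p x. prime p \<and> x > 0 \<and> (n = p ^ x \<or> n = 2 * p \<or> n = 2 * p ^ 2)"
proof -
  have no_factors: "a < 3 \<or> b < 3" if "n = a * b" "coprime a b" for a b
  proof (rule ccontr)
    assume "\<not> (a < 3 \<or> b < 3)"
    then show False
      using not_chordal_coprime[of "int a" "int b"] assms(2) that by simp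
  qed
  have double: ?thesis if "n = 2 * p ^ k" "prime p" "odd p" "k > 0" for p k
  proof -
    have "\<not> k \<ge> 3"
      using not_chordal_double_prime_power[of "int p" k] assms(2) that by auto
    then have "k = 1 \<or> k = 2"
      using that by auto
    then show ?thesis
      using that by (intro exI[of _ p] exI[of _ "1 :: nat"]) auto
  qed
  have split: "\<exists>p k c. prime p \<and> k > 0 \<and> \<not> p dvd c \<and> m = p ^ k * c" if "m \<ge> 2" for m :: nat
  proof -
    obtain p k c where "prime p" "\<not> p dvd c" "k > 0" "m = p ^ k * c"
      by (rule divide_out_primepow[of m]) (use \<open>m \<ge> 2\<close> in auto)
    then show ?thesis by blast
  qed
  obtain p k c where pk: "prime p" "k > 0" "\<not> p dvd c" "n = p ^ k * c"
    using split[OF assms(1)] by blast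
  have "c \<noteq> 0" using pk by (metis dvd_0_right)
  have cop: "coprime (p ^ k) c"
    using pk by (simp add: prime_imp_coprime)
  have "p ^ k \<ge> 2"
    using pk by (metis prime_ge_2_nat self_le_power order_trans one_le_numeral)
  with no_factors[OF pk(4) cop] \<open>c \<noteq> 0\<close> consider "c = 1" | "c = 2" | "p ^ k = 2" "c \<ge> 3"
    by linarith
  then show ?thesis
  proof cases
    case 1
    then show ?thesis using pk by auto
  next
    case 2
    then have "odd p" using cop pk by simp
    then show ?thesis using double[of p k] pk 2 by simp
  next
    case 3
    \<comment> \<open>Here \<open>n = 2 * c\<close>. A full prime power is split off
      \<open>c\<close>, and the factor 2 joins the other side, which forces
      \<open>d = 1\<close>.\<close>
    have "odd c" using cop 3 by simp
    obtain q j d where qj: "prime q" "j > 0" "\<not> q dvd d" "c = q ^ j * d"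
      using split[of c] 3 by auto
    have "odd q" "odd d"
      using \<open>odd c\<close> qj by auto
    have cop: "coprime (q ^ j) (2 * d)"
      using qj \<open>odd q\<close> by (simp add: prime_imp_coprime)
    have "q ^ j \<ge> 2" 
      using qj by (metis prime_ge_2_nat self_le_power order_trans one_le_numeral)
    moreover have "odd (q ^ j)" using \<open>odd q\<close> by simp
    ultimately have "q ^ j \<ge> 3"
      by (cases "q ^ j = 2") auto
    then have "2 * d < 3"
      using no_factors[OF _ cop] pk(4) qj 3 by auto
    with \<open>odd d\<close> have "d = 1" by (cases d) auto
    then show ?thesis
      using double[of q j] qj pk 3 \<open>odd q\<close> by simp
  qed
qed

theorem theorem2p16:
  fixes n :: nat
  assumes "n \<ge> 2"
  shows "chordal (with_proj (zero_divisor_graph (residue_ring (int n)))) \<longleftrightarrow>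
    (\<exists>(p::nat) (x::nat). prime p \<and> x > 0 \<and> (n = p ^ x \<or> n = 2 * p \<or> n = 2 * p ^ 2))"
proof
  assume "chordal (with_proj (zero_divisor_graph (residue_ring (int n))))"
  with assms show "\<exists>p x. prime p \<and> x > 0 \<and> (n = p ^ x \<or> n = 2 * p \<or> n = 2 * p ^ 2)"
    by (rule chordal_cases)
next
  assume "\<exists>p x. prime p \<and> x > 0 \<and> (n = p ^ x \<or> n = 2 * p \<or> n = 2 * p ^ 2)"
  then obtain p x :: nat where p: "prime p" and n: "n = p ^ x \<or> n = 2 * p \<or> n = 2 * p ^ 2"
    by blast
  \<comment> \<open>For \<open>p = 2\<close> the form \<open>2 * p ^ 2\<close> is 8, which is
    covered as a prime power.\<close>
  from n consider "n = p ^ x" | "n = 2 * p" | "n = 2 * p ^ 2" "odd p" | "n = 2 ^ 3"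
    using p by (cases "even p") (auto dest: primes_dvd_imp_eq[OF two_is_prime_nat])
  then show "chordal (with_proj (zero_divisor_graph (residue_ring (int n))))"
  proof cases
    case 1
    then show ?thesis using chordal_prime_power[of "int p" x] p by simp
  next
    case 2
    then show ?thesis using chordal_double_prime[of "int p"] p by simp
  next
    case 3
    then show ?thesis using chordal_double_prime_square[of "int p"] p by simp
  next
    case 4
    then show ?thesis using chordal_prime_power[of 2 3] by simp
  qed
qed

end
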